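(* There is an absolute constant $c>1/2$ such that for every prime $p$ and every positive integer $n$ that is sufficiently large in terms of $p$, we have $r_3(\mathbb{F}_p^n)\ge (cp)^n$.
   Context: For a finite abelian group $G$, $r_3(G)$ denotes the maximum possible size of a subset $A\subseteq G$ such that there do not exist distinct $x,y,z\in A$ with $x+z=y+y$. Here $\mathbb{F}_p^n$ is viewed as an abelian group under addition. *)

theory Defs
  imports Complex_Main "HOL-Number_Theory.Residues" "HOL-Algebra.Product_Groups"
begin

(* The groups of HOL-Algebra are written multiplicatively, so x + z = y + y reads
   x \<otimes> z = y \<otimes> y. *)
definition three_AP_free :: "('a, 'b) monoid_scheme \<Rightarrow> 'a set \<Rightarrow> bool" where
  "three_AP_free G A \<longleftrightarrow>
     \<not> (\<exists>x\<in>A. \<exists>y\<in>A. \<exists>z\<in>A. x \<noteq> y \<and> y \<noteq> z \<and> x \<noteq> z \<and> x \<otimes>\<^bsub>G\<^esub> z = y \<otimes>\<^bsub>G\<^esub> y)"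

(* Meaningful for finite G only: Max is unspecified on infinite sets. *)
definition r3 :: "('a, 'b) monoid_scheme \<Rightarrow> nat" where
  "r3 G = Max {card A | A. A \<subseteq> carrier G \<and> three_AP_free G A}"

definition Fp_power :: "nat \<Rightarrow> nat \<Rightarrow> (nat \<Rightarrow> int) monoid" where
  "Fp_power p n = product_group {..<n} (\<lambda>_. add_monoid (residue_ring (int p)))"

lemma carrier_Fp_power:
  "carrier (Fp_power p n) = (\<Pi>\<^sub>E i\<in>{..<n}. {0..int p - 1})"
  by (simp add: Fp_power_def residue_ring_def)

lemma finite_carrier_Fp_power: "finite (carrier (Fp_power p n))"
  by (simp add: carrier_Fp_power finite_PiE)

lemma card_carrier_Fp_power: "card (carrier (Fp_power p n)) = p ^ n"
  by (simp add: carrier_Fp_power card_PiE)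

lemma comm_group_Fp_power:
  assumes "prime p"
  shows "comm_group (Fp_power p n)"
proof -
  have "1 < int p"
    using prime_gt_1_nat[OF assms] by simp
  then interpret residues "int p" "residue_ring (int p)"
    by unfold_locales auto
  have "group (Fp_power p n)"
    unfolding Fp_power_def by (rule product_group) (rule add.is_group)
  moreover have "x \<otimes>\<^bsub>Fp_power p n\<^esub> y = y \<otimes>\<^bsub>Fp_power p n\<^esub> x" for x y
    by (simp add: Fp_power_def residue_ring_def add.commute)
  ultimately show ?thesis
    by (auto intro: group.group_comm_groupI)
qed

lemma r3_collection:
  assumes "finite (carrier G)"
  shows "finite {card A | A. A \<subseteq> carrier G \<and> three_AP_free G A}"
    and "{card A | A. A \<subseteq> carrier G \<and> three_AP_free G A} \<noteq> {}"
proof -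
  show "finite {card A | A. A \<subseteq> carrier G \<and> three_AP_free G A}"
    using assms by (auto intro: finite_subset[of _ "card ` Pow (carrier G)"])
  have "three_AP_free G {}"
    by (simp add: three_AP_free_def)
  then show "{card A | A. A \<subseteq> carrier G \<and> three_AP_free G A} \<noteq> {}"
    by auto
qed

lemma card_le_r3:
  assumes "finite (carrier G)" "A \<subseteq> carrier G" "three_AP_free G A"
  shows "card A \<le> r3 G"
  unfolding r3_def using r3_collection(1)[OF assms(1)] assms(2,3) by (intro Max_ge) auto

lemma r3_attained:
  assumes "finite (carrier G)"
  obtains A where "A \<subseteq> carrier G" "three_AP_free G A" "card A = r3 G"
  using Max_in[OF r3_collection[OF assms]] unfolding r3_def by auto

end

theory Submission
  imports Defs
begin

text \<open>
  Suppose a set \<open>D\<close> in \<open>\<int>\<^sub>p\<^sup>2\<close> carries an integer function \<open>F\<close> with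
  \<open>2 F(y) < F(x) + F(z)\<close> for every nontrivial progression \<open>x, y, z\<close> in \<open>D\<close>. Then each level set of
  \<open>F(d\<^sub>1) + \<dots> + F(d\<^sub>m)\<close> on \<open>D\<^sup>m\<close> is free of progressions, and there are only \<open>O(m)\<close> levels, so it
  is enough to find such a \<open>D\<close> with more than \<open>(c p)\<^sup>2\<close> elements.

  Scale \<open>\<int>\<^sub>p\<^sup>2\<close> to the torus \<open>\<real>\<^sup>2/\<int>\<^sup>2\<close>. A convex tile of the lattice \<open>(1/2)\<int>\<^sup>2\<close> has area \<open>1/4\<close>,
  and progressions inside it do not wrap around, so any strictly convex function serves as \<open>F\<close>;
  a square tile gives the classical constant \<open>1/2\<close>. For the sheared tile
  \<open>0 \<le> y < 1/2\<close>, \<open>0 \<le> 2 x - y < 1\<close>, the translate of the corner \<open>(0, 0)\<close> by the 2-torsion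
  point \<open>(0, 1/2)\<close> keeps away from the tile. So a copy of a small region near that corner can be
  added to \<open>D\<close>, with the values of \<open>F\<close> copied as well: the translation is invisible in \<open>2 y\<close>, and
  a progression with exactly one end in the copy cannot have its midpoint near the corner,
  where \<open>F\<close> is chosen to be very large.
\<close>

section \<open>Lower bounds for \<open>r3\<close> from strictly convex functions modulo
  \<open>p\<close>\<close>

definition strict_height :: "int \<Rightarrow> (int \<times> int) set \<Rightarrow> (int \<times> int \<Rightarrow> nat) \<Rightarrow> bool" where
  "strict_height p D F \<longleftrightarrow>
     (\<forall>x\<in>D. \<forall>y\<in>D. \<forall>z\<in>D.
        [fst x + fst z = 2 * fst y] (mod p) \<longrightarrow> [snd x + snd z = 2 * snd y] (mod p) \<longrightarrow>
        2 * F y \<le> F x + F z \<and> (F x + F z = 2 * F y \<longrightarrow> x = z))"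

lemma pigeonhole_fibre:
  fixes g :: "'a \<Rightarrow> nat"
  assumes "finite W" "\<And>w. w \<in> W \<Longrightarrow> g w \<le> k"
  obtains s where "card W \<le> (k + 1) * card {w \<in> W. g w = s}"
proof -
  have "\<exists>s. card W \<le> (k + 1) * card {w \<in> W. g w = s}"
  proof (rule ccontr)
    assume "\<not> ?thesis"
    then have less: "(k + 1) * card {w \<in> W. g w = s} < card W" for s
      by (simp add: not_le)
    have "W = (\<Union>s\<in>{..k}. {w \<in> W. g w = s})"
      using assms(2) by auto
    then have "card W = (\<Sum>s\<le>k. card {w \<in> W. g w = s})"
      using assms(1) card_UN_disjoint[of "{..k}" "\<lambda>s. {w \<in> W. g w = s}"] by auto
    then have "(k + 1) * card W = (\<Sum>s\<le>k. (k + 1) * card {w \<in> W. g w = s})"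
      by (simp add: sum_distrib_left)
    also have "\<dots> < (\<Sum>s\<le>k. card W)"
      by (intro sum_strict_mono less) auto
    finally show False
      by simp
  qed
  then show ?thesis
    using that by blast
qed

text \<open>The padding by 0 serves odd \<open>n\<close>, where one coordinate stays
  unpaired.\<close>

definition concat_pairs :: "nat \<Rightarrow> nat \<Rightarrow> (nat \<Rightarrow> int \<times> int) \<Rightarrow> nat \<Rightarrow> int" where
  "concat_pairs m n w =
     (\<lambda>i\<in>{..<n}. if i < m then fst (w i) else if i < 2 * m then snd (w (i - m)) else 0)"

lemma concat_pairs_nth:
  assumes "2 * m \<le> n" "j < m"
  shows "concat_pairs m n w j = fst (w j)" "concat_pairs m n w (m + j) = snd (w j)"
  using assms by (auto simp: concat_pairs_def)

lemma inj_concat_pairs: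
  assumes "2 * m \<le> n"
  shows "inj_on (concat_pairs m n) ({..<m} \<rightarrow>\<^sub>E D)"
proof (rule inj_onI)
  fix v w assume v: "v \<in> {..<m} \<rightarrow>\<^sub>E D" and w: "w \<in> {..<m} \<rightarrow>\<^sub>E D"
    and eq: "concat_pairs m n v = concat_pairs m n w"
  show "v = w"
  proof (rule PiE_ext[OF v w])
    fix j assume "j \<in> {..<m}"
    then show "v j = w j"
      using concat_pairs_nth[OF assms, of j v] concat_pairs_nth[OF assms, of j w] eq
      by (simp add: prod_eq_iff)
  qed
qed

lemma Fp_power_mult:
  assumes "i < n"
  shows "(x \<otimes>\<^bsub>Fp_power p n\<^esub> y) i = (x i + y i) mod int p"
  using assms by (simp add: Fp_power_def residue_ring_def)

text \<open>The inequality for \<open>F\<close> holds at every index of a progression and is strict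
  where the ends differ; summation would give \<open>2 * s < s + s\<close>.\<close>

lemma three_AP_free_level_set:
  assumes F: "strict_height (int p) D F" and mn: "2 * m \<le> n"
  shows "three_AP_free (Fp_power p n)
           (concat_pairs m n ` {w \<in> {..<m} \<rightarrow>\<^sub>E D. (\<Sum>j<m. F (w j)) = s})"
proof -
  have False
    if u: "u \<in> {..<m} \<rightarrow>\<^sub>E D" "(\<Sum>j<m. F (u j)) = s"
      and v: "v \<in> {..<m} \<rightarrow>\<^sub>E D" "(\<Sum>j<m. F (v j)) = s"
      and w: "w \<in> {..<m} \<rightarrow>\<^sub>E D" "(\<Sum>j<m. F (w j)) = s"
      and neq: "concat_pairs m n u \<noteq> concat_pairs m n w"
      and AP: "concat_pairs m n u \<otimes>\<^bsub>Fp_power p n\<^esub> concat_pairs m n w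
             = concat_pairs m n v \<otimes>\<^bsub>Fp_power p n\<^esub> concat_pairs m n v"
    for u v w
  proof -
    have step: "2 * F (v j) \<le> F (u j) + F (w j) \<and> (F (u j) + F (w j) = 2 * F (v j) \<longrightarrow> u j = w j)"
      if j: "j < m" for j
    proof -
      have c: "[concat_pairs m n u i + concat_pairs m n w i = 2 * concat_pairs m n v i] (mod int p)"
        if "i < n" for i
        using fun_cong[OF AP, of i] that by (simp add: Fp_power_mult cong_def)
      have "[fst (u j) + fst (w j) = 2 * fst (v j)] (mod int p)"
        using c[of j] j mn by (simp add: concat_pairs_nth)
      moreover have "[snd (u j) + snd (w j) = 2 * snd (v j)] (mod int p)"
        using c[of "m + j"] j mn by (simp add: concat_pairs_nth)
      moreover have "u j \<in> D" "v j \<in> D" "w j \<in> D"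
        using u(1) v(1) w(1) j by (auto simp: PiE_iff)
      ultimately show ?thesis
        using F unfolding strict_height_def by blast
    qed
    have "\<exists>j<m. u j \<noteq> w j"
      using neq u(1) w(1) by (metis PiE_ext lessThan_iff)
    then obtain j where "j < m" "u j \<noteq> w j"
      by blast
    then have "2 * F (v j) < F (u j) + F (w j)"
      using step[of j] by linarith
    then have "(\<Sum>j<m. 2 * F (v j)) < (\<Sum>j<m. F (u j) + F (w j))"
      using step \<open>j < m\<close> by (intro sum_strict_mono_ex1) blast+
    then show False
      using u(2) v(2) w(2) by (simp add: sum.distrib flip: sum_distrib_left)
  qed
  then show ?thesis
    unfolding three_AP_free_def by blast
qed

lemma r3_lower_bound:
  assumes p: "p > 0" and D: "D \<subseteq> {0..int p - 1} \<times> {0..int p - 1}"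
    and F: "strict_height (int p) D F" and mn: "2 * m \<le> n"
    and M: "\<And>x. x \<in> D \<Longrightarrow> F x \<le> M"
  shows "card D ^ m \<le> (m * M + 1) * r3 (Fp_power p n)"
proof -
  let ?W = "{..<m} \<rightarrow>\<^sub>E D"
  have finD: "finite D"
    using D by (rule finite_subset) auto
  then have finW: "finite ?W"
    by (auto intro: finite_PiE)
  have bd: "(\<Sum>j<m. F (w j)) \<le> m * M" if "w \<in> ?W" for w
    using sum_bounded_above[of "{..<m}" "\<lambda>j. F (w j)" M] that M by (auto simp: PiE_iff)
  obtain s where s: "card ?W \<le> (m * M + 1) * card {w \<in> ?W. (\<Sum>j<m. F (w j)) = s}"
    using pigeonhole_fibre[OF finW, of "\<lambda>w. \<Sum>j<m. F (w j)" "m * M"] bd by blast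
  let ?A = "concat_pairs m n ` {w \<in> ?W. (\<Sum>j<m. F (w j)) = s}"
  have "card {w \<in> ?W. (\<Sum>j<m. F (w j)) = s} = card ?A"
    by (rule card_image[symmetric]) (rule inj_on_subset[OF inj_concat_pairs[OF mn, of D]], auto)
  also have "\<dots> \<le> r3 (Fp_power p n)"
  proof (intro card_le_r3 finite_carrier_Fp_power three_AP_free_level_set F mn)
    show "?A \<subseteq> carrier (Fp_power p n)"
    proof
      fix a assume "a \<in> ?A"
      then obtain w where w: "w \<in> ?W" "a = concat_pairs m n w"
        by blast
      have "fst (w j) \<in> {0..int p - 1}" "snd (w j) \<in> {0..int p - 1}" if "j < m" for j
        using subsetD[OF D PiE_mem[OF w(1)], of j] that by (auto simp: mem_Times_iff)
      then show "a \<in> carrier (Fp_power p n)"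
        using p unfolding carrier_Fp_power w(2) concat_pairs_def by (auto simp: PiE_iff)
    qed
  qed
  finally have "(m * M + 1) * card {w \<in> ?W. (\<Sum>j<m. F (w j)) = s}
      \<le> (m * M + 1) * r3 (Fp_power p n)"
    by (rule mult_le_mono2)
  moreover have "card ?W = card D ^ m"
    by (simp add: card_PiE)
  ultimately show ?thesis
    using s by simp
qed

lemma r3_eventually_ge:
  fixes b :: real
  assumes p: "p > 0" and D: "D \<subseteq> {0..int p - 1} \<times> {0..int p - 1}"
    and F: "strict_height (int p) D F" and b: "b > 0" "b\<^sup>2 < card D"
  shows "\<exists>N. \<forall>n\<ge>N. b ^ n \<le> r3 (Fp_power p n)"
proof -
  have finD: "finite D"
    using D by (rule finite_subset) auto
  obtain M where M: "\<And>x. x \<in> D \<Longrightarrow> F x \<le> M"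
    using finite_imageI[OF finD, of F] by (metis finite_nat_set_iff_bounded_le imageI)
  define t where "t = b\<^sup>2 / card D"
  have d0: "real (card D) > 0"
    using b by (smt (verit) zero_le_power2)
  have t: "0 \<le> t" "t < 1"
    using b d0 by (auto simp: t_def)
  have lim: "(\<lambda>m. real m * t ^ m) \<longlonglongrightarrow> 0" "(\<lambda>m. t ^ m) \<longlonglongrightarrow> 0"
    using t by (auto intro: powser_times_n_limit_0 LIMSEQ_power_zero)
  have "(\<lambda>m. (1 + b) * (M * (real m * t ^ m) + t ^ m)) \<longlonglongrightarrow> (1 + b) * (real M * 0 + 0)"
    by (rule tendsto_mult_left[OF tendsto_add[OF tendsto_mult_left[OF lim(1)] lim(2)]])
  \<comment> \<open>The number of levels is linear in \<open>m\<close> and loses to the decay of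
    \<open>t ^ m\<close>; the factor \<open>1 + b\<close> pays for the unpaired coordinate.\<close>
  then have "\<forall>\<^sub>F m in sequentially. (1 + b) * (M * (real m * t ^ m) + t ^ m) < 1"
    by (rule order_tendstoD) simp
  then obtain N where N: "\<And>m. m \<ge> N \<Longrightarrow> (1 + b) * (M * (real m * t ^ m) + t ^ m) < 1"
    by (auto simp: eventually_sequentially)
  have "b ^ n \<le> r3 (Fp_power p n)" if n: "n \<ge> 2 * N" for n
  proof -
    define m where "m = n div 2"
    have m: "m \<ge> N" "2 * m \<le> n"
      using n by (auto simp: m_def)
    have "n = 2 * m \<or> n = Suc (2 * m)"
      unfolding m_def by presburger
    then have bn: "b ^ n \<le> (1 + b) * (b\<^sup>2) ^ m"
      using b(1) by (auto simp: power_mult distrib_right)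
    have bm: "(b\<^sup>2) ^ m = t ^ m * card D ^ m"
      using d0 by (simp add: t_def power_divide)
    have "real (card D ^ m) \<le> real ((m * M + 1) * r3 (Fp_power p n))"
      using r3_lower_bound[OF p D F m(2) M] of_nat_le_iff by blast
    then have "(1 + b) * (t ^ m * card D ^ m) \<le> (1 + b) * (t ^ m * ((m * M + 1) * r3 (Fp_power p n)))"
      using b(1) t by (intro mult_left_mono) auto
    also have "\<dots> = ((1 + b) * (M * (real m * t ^ m) + t ^ m)) * r3 (Fp_power p n)"
      by (simp add: algebra_simps)
    also have "\<dots> \<le> 1 * real (r3 (Fp_power p n))"
      using N[OF m(1)] by (intro mult_right_mono) auto
    finally show ?thesis
      using bn bm by simp
  qed
  then show ?thesis
    by blast
qed

section \<open>A convex tile with an extra region, and its height function\<close>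

definition tile :: "int \<Rightarrow> (int \<times> int) set" where
  "tile p = {(x, y). 0 \<le> y \<and> 2 * y < p \<and> y \<le> 2 * x \<and> 2 * x < y + p}"

text \<open>Translated back by \<open>(0, p/2)\<close>, this is the rectangle \<open>[p/40, p/20) \<times> [0, p/20]\<close> of the tile.\<close>

definition spare :: "int \<Rightarrow> (int \<times> int) set" where
  "spare p = {(x, y). p \<le> 40 * x \<and> 20 * x < p \<and> p \<le> 2 * y \<and> 20 * y \<le> 11 * p}"

text \<open>
  Twice the second coordinate after the translation back; the doubling keeps \<open>p/2\<close> integral.
\<close>

definition lift :: "int \<Rightarrow> int \<Rightarrow> int" where
  "lift p y = (if 2 * y < p then 2 * y else 2 * y - p)"

text \<open>
  With \<open>w = 2 y\<close> this is \<open>4 p\<^sup>2\<close> times \<open>x\<^sup>2 + y\<^sup>2 + 40 max(0, 1/10 - x)\<close> in torus coordinates. The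
  last term is at least \<open>2\<close> on the added region, whereas the quadratic part is below \<open>1\<close> on the tile.
\<close>

definition cvx :: "int \<Rightarrow> int \<Rightarrow> int \<Rightarrow> int" where
  "cvx p x w = 4 * x\<^sup>2 + w\<^sup>2 + 16 * p * max 0 (p - 10 * x)"

text \<open>The quadratic part obeys the parallelogram law, whose remainder vanishes only for equal
  ends; the \<open>max\<close> term is convex.\<close>

lemma cvx_midpoint:
  assumes p: "p > 0" and x: "x1 + z1 = 2 * y1" and w: "xw + zw = 2 * yw"
  shows "2 * cvx p y1 yw \<le> cvx p x1 xw + cvx p z1 zw"
    and "cvx p x1 xw + cvx p z1 zw = 2 * cvx p y1 yw \<Longrightarrow> x1 = z1 \<and> xw = zw"
proof -
  have z: "z1 = 2 * y1 - x1" "zw = 2 * yw - xw"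
    using x w by auto
  have "2 * max 0 (p - 10 * y1) \<le> max 0 (p - 10 * x1) + max 0 (p - 10 * z1)"
    using x by (simp add: max_def)
  then have "16 * p * (2 * max 0 (p - 10 * y1)) \<le> 16 * p * (max 0 (p - 10 * x1) + max 0 (p - 10 * z1))"
    using p by (intro mult_left_mono) simp_all
  moreover have "4 * x1\<^sup>2 + xw\<^sup>2 + (4 * z1\<^sup>2 + zw\<^sup>2) =
      2 * (4 * y1\<^sup>2 + yw\<^sup>2) + (8 * (x1 - y1)\<^sup>2 + 2 * (xw - yw)\<^sup>2)"
    unfolding z by (simp add: power2_eq_square algebra_simps)
  ultimately have *: "2 * cvx p y1 yw + (8 * (x1 - y1)\<^sup>2 + 2 * (xw - yw)\<^sup>2)
      \<le> cvx p x1 xw + cvx p z1 zw"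
    unfolding cvx_def by (simp add: algebra_simps)
  then show "2 * cvx p y1 yw \<le> cvx p x1 xw + cvx p z1 zw"
    by (smt (verit) zero_le_power2)
  assume "cvx p x1 xw + cvx p z1 zw = 2 * cvx p y1 yw"
  with * have "(x1 - y1)\<^sup>2 \<le> 0 \<and> (xw - yw)\<^sup>2 \<le> 0"
    by (smt (verit) zero_le_power2)
  then show "x1 = z1 \<and> xw = zw"
    using z by (auto simp: power2_less_eq_zero_iff)
qed

text \<open>These inequalities describe the tile in the coordinates \<open>(x, 2 y)\<close>; the
  extra region, translated back, lies inside it.\<close>

lemma lift_bounds:
  assumes "(x, y) \<in> tile p \<union> spare p"
  shows "0 \<le> lift p y" "lift p y < p" "lift p y \<le> 4 * x" "4 * x < lift p y + 2 * p"
  using assms by (auto simp: tile_def spare_def lift_def)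

text \<open>Odd \<open>k\<close> arises when exactly one end is translated. A midpoint with
  \<open>10 * y1 < p\<close> is geometrically impossible; elsewhere the large value at
  \<open>x\<close> wins.\<close>

lemma spare_midpoint:
  assumes x: "(x1, x2) \<in> spare p"
    and y: "(y1, y2) \<in> tile p \<union> spare p" and z: "(z1, z2) \<in> tile p \<union> spare p"
    and a: "x1 + z1 = 2 * y1 + p * a"
    and k: "lift p x2 + lift p z2 = 2 * lift p y2 + p * k" "odd k"
  shows "2 * cvx p y1 (lift p y2) < cvx p x1 (lift p x2) + cvx p z1 (lift p z2)"
proof -
  note hy = lift_bounds[OF y] and hz = lift_bounds[OF z]
  have p: "p > 0"
    using hy by simp
  have hx: "p \<le> 40 * x1" "20 * x1 < p" "0 \<le> lift p x2" "10 * lift p x2 \<le> p"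
    using x p by (auto simp: spare_def lift_def)
  have far: "p \<le> 10 * y1"
  proof (rule ccontr)
    assume near: "\<not> p \<le> 10 * y1"
    have "p * (-2) < p * k" "p * k < p * 2"
      using k hy hx hz near by linarith+
    then have "-2 < k" "k < 2"
      using p by (simp_all only: mult_less_cancel_left_pos)
    then have "k = 1 \<or> k = -1"
      using k(2) by presburger
    then have "k = 1"
      using k hy hx hz near by auto
    \<comment> \<open>So \<open>z\<close> is near the top of the tile, where the shear gives
      \<open>z1 >= 9 p/40\<close>. Then \<open>x1 + z1 - 2 * y1\<close> is a multiple of
      \<open>p\<close> strictly between 0 and \<open>p\<close>.\<close>
    then have "10 * lift p z2 \<ge> 9 * p"
      using k hy hx hz by auto
    then have "p * 0 < p * a" "p * a < p * 1"
      using a hy hx hz near by linarith+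
    then have "0 < a" "a < 1"
      using p by (simp_all only: mult_less_cancel_left_pos)
    then show False
      by simp
  qed
  \<comment> \<open>Without the \<open>max\<close> term, twice the value at \<open>y\<close> is at
    most \<open>6.5 p^2\<close>, while the value at \<open>x\<close> exceeds
    \<open>8 p^2\<close>.\<close>
  have "(4 * y1)\<^sup>2 \<le> (3 * p)\<^sup>2" "(lift p y2)\<^sup>2 \<le> p\<^sup>2"
    using hy p by (intro power_mono; linarith)+
  then have "16 * cvx p y1 (lift p y2) \<le> 52 * p\<^sup>2"
    using far by (simp add: cvx_def power_mult_distrib)
  moreover have "16 * p * p < 16 * p * (2 * (p - 10 * x1))"
    using hx p by (intro mult_strict_left_mono) auto
  then have "8 * p\<^sup>2 < 16 * p * (p - 10 * x1)"
    by (simp add: power2_eq_square algebra_simps)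
  then have "8 * p\<^sup>2 < cvx p x1 (lift p x2)"
    using hx by (simp add: cvx_def add_nonneg_pos add_strict_increasing2)
  moreover have "0 \<le> cvx p z1 (lift p z2)"
    using p by (simp add: cvx_def)
  moreover have "0 \<le> p\<^sup>2"
    by simp
  ultimately show ?thesis
    by linarith
qed

lemma strict_height_tile_spare:
  assumes p: "p > 0"
  shows "strict_height p (tile p \<union> spare p) (\<lambda>(x, y). nat (cvx p x (lift p y)))"
proof -
  have main: "2 * cvx p y1 (lift p y2) \<le> cvx p x1 (lift p x2) + cvx p z1 (lift p z2) \<and>
      (cvx p x1 (lift p x2) + cvx p z1 (lift p z2) = 2 * cvx p y1 (lift p y2)
         \<longrightarrow> x1 = z1 \<and> x2 = z2)"
    if x: "(x1, x2) \<in> tile p \<union> spare p" and y: "(y1, y2) \<in> tile p \<union> spare p"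
      and z: "(z1, z2) \<in> tile p \<union> spare p"
      and c: "[x1 + z1 = 2 * y1] (mod p)" "[x2 + z2 = 2 * y2] (mod p)"
    for x1 x2 y1 y2 z1 z2
  proof -
    note hx = lift_bounds[OF x] and hy = lift_bounds[OF y] and hz = lift_bounds[OF z]
    obtain a where a: "x1 + z1 = 2 * y1 + p * a"
      using c(1) by (metis cong_iff_lin cong_sym)
    obtain b where b: "x2 + z2 = 2 * y2 + p * b"
      using c(2) by (metis cong_iff_lin cong_sym)
    define e :: "int \<Rightarrow> int" where "e = (\<lambda>y. if 2 * y < p then 0 else 1)"
    have lift: "lift p y = 2 * y - p * e y" for y
      by (simp add: lift_def e_def)
    \<comment> \<open>\<open>e\<close> marks the points of the extra region, so \<open>k\<close> is
      odd exactly when one end is marked and the other is not; the midpoint does not affect the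
      parity.\<close>
    define k where "k = 2 * e y2 + 2 * b - e x2 - e z2"
    have k: "lift p x2 + lift p z2 = 2 * lift p y2 + p * k"
      using b by (simp add: lift k_def algebra_simps)
    show ?thesis
    proof (cases "odd k")
      case True
      then have "e x2 = 1 \<or> e z2 = 1"
        by (auto simp: k_def e_def split: if_splits)
      then have "(x1, x2) \<in> spare p \<or> (z1, z2) \<in> spare p"
        using x z by (auto simp: e_def tile_def split: if_splits)
      then have "2 * cvx p y1 (lift p y2) < cvx p x1 (lift p x2) + cvx p z1 (lift p z2)"
        using spare_midpoint[OF _ y z a k True] spare_midpoint[OF _ y x _ _ True, of z1 z2 a] a k
        by (auto simp: add.commute)
      then show ?thesis
        by simp
    next
      case False
      \<comment> \<open>Lifts lie in \<open>[0, p)\<close>, so even \<open>k\<close> is 0. Then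
        \<open>a = 0\<close> as well, and the progression holds over the integers.\<close>
      have "p * (-2) < p * k" "p * k < p * 2"
        using k hx hy hz by linarith+
      then have "-2 < k" "k < 2"
        using p by (simp_all only: mult_less_cancel_left_pos)
      then have k0: "k = 0"
        using False by presburger
      have w: "lift p x2 + lift p z2 = 2 * lift p y2"
        using k k0 by simp
      have "p * (-1) < p * a" "p * a < p * 1"
        using a w hx hy hz by linarith+
      then have "-1 < a" "a < 1"
        using p by (simp_all only: mult_less_cancel_left_pos)
      then have a0: "a = 0"
        by simp
      \<comment> \<open>Equal lifts alone would let \<open>x2\<close> and \<open>z2\<close> differ
        by the translation; the parity of \<open>k\<close> excludes this.\<close>
      have "x2 = z2" if "lift p x2 = lift p z2"
      proof -
        have "even (e x2 - e z2)"
          using k0 unfolding k_def by presburger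
        then have "e x2 = e z2"
          by (auto simp: e_def split: if_splits)
        then show ?thesis
          using that by (simp add: lift)
      qed
      moreover have "x1 + z1 = 2 * y1"
        using a a0 by simp
      ultimately show ?thesis
        using cvx_midpoint[OF p _ w] by blast
    qed
  qed
  have nonneg: "0 \<le> cvx p x w" for x w
    using p by (simp add: cvx_def)
  show ?thesis
    unfolding strict_height_def
  proof (intro ballI impI)
    fix x y z assume "x \<in> tile p \<union> spare p" "y \<in> tile p \<union> spare p" "z \<in> tile p \<union> spare p"
      and "[fst x + fst z = 2 * fst y] (mod p)" "[snd x + snd z = 2 * snd y] (mod p)"
    then have "2 * cvx p (fst y) (lift p (snd y))
        \<le> cvx p (fst x) (lift p (snd x)) + cvx p (fst z) (lift p (snd z)) \<and>
      (cvx p (fst x) (lift p (snd x)) + cvx p (fst z) (lift p (snd z))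
        = 2 * cvx p (fst y) (lift p (snd y)) \<longrightarrow> fst x = fst z \<and> snd x = snd z)"
      by (intro main) simp_all
    then show "2 * (case y of (a, b) \<Rightarrow> nat (cvx p a (lift p b)))
        \<le> (case x of (a, b) \<Rightarrow> nat (cvx p a (lift p b))) + (case z of (a, b) \<Rightarrow> nat (cvx p a (lift p b))) \<and>
      ((case x of (a, b) \<Rightarrow> nat (cvx p a (lift p b))) + (case z of (a, b) \<Rightarrow> nat (cvx p a (lift p b)))
        = 2 * (case y of (a, b) \<Rightarrow> nat (cvx p a (lift p b))) \<longrightarrow> x = z)"
      using nonneg[of "fst x" "lift p (snd x)"] nonneg[of "fst y" "lift p (snd y)"]
        nonneg[of "fst z" "lift p (snd z)"]
      unfolding case_prod_beta prod_eq_iff by linarith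
  qed
qed

section \<open>Counting lattice points\<close>

lemma card_tile:
  fixes q :: nat
  defines "p \<equiv> 2 * int q + 1"
  shows "p * (p + 1) \<le> 4 * int (card (tile p))"
proof -
  define R where "R y = {(int y + 1) div 2..(int y + 2 * int q) div 2}" for y :: nat
  have "tile p = (\<lambda>(y, x). (x, int y)) ` (SIGMA y:{..q}. R y)"
  proof (intro equalityI subsetI)
    fix c assume "c \<in> tile p"
    then obtain x y where c: "c = (x, y)" and "0 \<le> y" "2 * y < p" "y \<le> 2 * x" "2 * x < y + p"
      by (auto simp: tile_def)
    then have "c = (\<lambda>(y, x). (x, int y)) (nat y, x)" "(nat y, x) \<in> (SIGMA y:{..q}. R y)"
      by (auto simp: p_def R_def)
    then show "c \<in> (\<lambda>(y, x). (x, int y)) ` (SIGMA y:{..q}. R y)"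
      by blast
  qed (auto simp: tile_def p_def R_def)
  moreover have "inj_on (\<lambda>(y, x). (x, int y)) (SIGMA y:{..q}. R y)"
    by (auto simp: inj_on_def)
  ultimately have "card (tile p) = card (SIGMA y:{..q}. R y)"
    by (simp add: card_image)
  also have "\<dots> = (\<Sum>y\<le>q. card (R y))"
    by (simp add: R_def)
  also have "\<dots> = (\<Sum>y\<le>q. if even y then q + 1 else q)"
    by (intro sum.cong) (auto simp: R_def elim!: evenE oddE)
  finally have "card (tile p) = (\<Sum>y\<le>q. if even y then q + 1 else q)" .
  \<comment> \<open>The summation bound is separated from the row length \<open>q\<close> to allow
    induction.\<close>
  moreover have "2 * (\<Sum>y\<le>r. if even y then q + 1 else q) = (r + 1) * (2 * q + 1) + of_bool (even r)"
    for r
    by (induction r) auto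
  from this[of q] have "(q + 1) * (2 * q + 1) \<le> 2 * (\<Sum>y\<le>q. if even y then q + 1 else q)"
    by simp
  ultimately have "(q + 1) * (2 * q + 1) \<le> 2 * card (tile p)"
    by simp
  then have "int ((q + 1) * (2 * q + 1)) \<le> int (2 * card (tile p))"
    by (simp only: of_nat_le_iff)
  then show ?thesis
    by (simp add: p_def algebra_simps)
qed

lemma tile_spare_subset: "tile p \<union> spare p \<subseteq> {0..p - 1} \<times> {0..p - 1}"
  by (auto simp: tile_def spare_def)

lemma card_spare:
  fixes q :: nat
  defines "p \<equiv> 2 * int q + 1"
  shows "2 * (p div 40)\<^sup>2 \<le> int (card (spare p))"
proof -
  define t where "t = p div 40"
  have t: "40 * t < p" "p < 40 * (t + 1)" "0 \<le> t"
    unfolding t_def p_def by presburger+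
  have "{t + 1..2 * t} \<times> {int q + 1..int q + 2 * t} \<subseteq> spare p"
    using t by (auto simp: spare_def p_def)
  moreover have "finite (spare p)"
    using tile_spare_subset[of p] by (rule finite_subset[OF order_trans[OF Un_upper2]]) auto
  ultimately have "card ({t + 1..2 * t} \<times> {int q + 1..int q + 2 * t}) \<le> card (spare p)"
    by (rule card_mono[rotated])
  then have "nat t * nat (2 * t) \<le> card (spare p)"
    by simp
  then have "int (nat t * nat (2 * t)) \<le> int (card (spare p))"
    by (simp only: of_nat_le_iff)
  then show ?thesis
    using t by (simp add: t_def[symmetric] power2_eq_square)
qed

text \<open>Here \<open>801/3200 = 1/4 + 1/3200\<close>. For \<open>p >= 40\<close> rounding down
  loses at most half of \<open>p/40\<close>, so the extra region supplies at least
  \<open>p^2/3200\<close> points; for smaller \<open>p\<close> the surplus \<open>p/4\<close> of the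
  tile suffices.\<close>

lemma card_tile_spare:
  fixes q :: nat
  defines "p \<equiv> 2 * int q + 1"
  shows "801 * p\<^sup>2 \<le> 3200 * int (card (tile p \<union> spare p))"
proof -
  have "finite (tile p \<union> spare p)"
    using tile_spare_subset by (rule finite_subset) auto
  moreover have "tile p \<inter> spare p = {}"
    by (auto simp: tile_def spare_def)
  ultimately have "card (tile p \<union> spare p) = card (tile p) + card (spare p)"
    by (simp add: card_Un_disjoint)
  then have *: "p\<^sup>2 + p + 8 * (p div 40)\<^sup>2 \<le> 4 * int (card (tile p \<union> spare p))"
    using card_tile[of q] card_spare[of q] by (simp add: p_def power2_eq_square algebra_simps)
  have p: "p > 0"
    by (simp add: p_def)
  have "p\<^sup>2 \<le> 800 * p + 6400 * (p div 40)\<^sup>2"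
  proof (cases "p < 40")
    case True
    then have "p * p \<le> 800 * p"
      using p by (intro mult_right_mono) auto
    then show ?thesis
      by (simp add: power2_eq_square add_increasing2)
  next
    case False
    then have "p \<le> 80 * (p div 40)"
      by presburger
    then have "p\<^sup>2 \<le> (80 * (p div 40))\<^sup>2"
      using p by (intro power_mono) auto
    then show ?thesis
      using p by (simp add: power_mult_distrib)
  qed
  then show ?thesis
    using * by linarith
qed

section \<open>The prime 2 and the choice of the constant\<close>

theorem theorem1p2:
  shows "\<exists>c::real. c > 1/2 \<and>
    (\<forall>p::nat. prime p \<longrightarrow>
      (\<exists>N::nat. \<forall>n::nat. n > 0 \<and> n \<ge> N \<longrightarrow>
        real (r3 (Fp_power p n)) \<ge> (c * real p) ^ n))"
proof (intro exI[of _ "5001 / 10000"] conjI allI impI)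
  fix p :: nat assume "prime p"
  then have p: "p > 1"
    by (rule prime_gt_1_nat)
  have "\<exists>D F. D \<subseteq> {0..int p - 1} \<times> {0..int p - 1} \<and> strict_height (int p) D F \<and>
      801 * p\<^sup>2 \<le> 3200 * card D"
  proof (cases "p = 2")
    \<comment> \<open>Modulo 2 the ends of a progression agree, so the whole plane with a constant
      height works.\<close>
    case True
    have parity: "a = b" if "a \<in> {0..1}" "b \<in> {0..1}" "[a + b = 2 * c] (mod 2)" for a b c :: int
      using that unfolding cong_def atLeastAtMost_iff by presburger
    have "strict_height 2 ({0..1} \<times> {0..1}) (\<lambda>_. 0)"
      unfolding strict_height_def using parity by (auto simp: prod_eq_iff)
    then show ?thesis
      using True by (intro exI[of _ "{0..1} \<times> {0..1}"] exI[of _ "\<lambda>_. 0"]) auto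
  next
    case False
    then have "odd p"
      using \<open>prime p\<close> p prime_odd_nat by force
    then obtain q where q: "int p = 2 * int q + 1"
      by (auto elim!: oddE)
    have "int (801 * p\<^sup>2) \<le> int (3200 * card (tile (int p) \<union> spare (int p)))"
      using card_tile_spare[of q] by (simp add: q)
    then have "801 * p\<^sup>2 \<le> 3200 * card (tile (int p) \<union> spare (int p))"
      by (simp only: of_nat_le_iff)
    moreover have "strict_height (int p) (tile (int p) \<union> spare (int p))
        (\<lambda>(x, y). nat (cvx (int p) x (lift (int p) y)))"
      using p by (intro strict_height_tile_spare) simp
    ultimately show ?thesis
      using tile_spare_subset by blast
  qed
  then obtain D F where D: "D \<subseteq> {0..int p - 1} \<times> {0..int p - 1}"
    and F: "strict_height (int p) D F" and card: "801 * p\<^sup>2 \<le> 3200 * card D"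
    by blast
  have "real (801 * p\<^sup>2) \<le> real (3200 * card D)"
    using card by (simp only: of_nat_le_iff)
  \<comment> \<open>Any constant above 1/2 and below the square root of \<open>801/3200\<close>,
    about 0.5003, would serve.\<close>
  moreover have "(5001 / 10000 * real p)\<^sup>2 < 801 / 3200 * (real p)\<^sup>2"
    using p by (simp add: power_mult_distrib power_divide)
  ultimately have "(5001 / 10000 * real p)\<^sup>2 < card D"
    by simp
  then show "\<exists>N::nat. \<forall>n::nat. n > 0 \<and> n \<ge> N \<longrightarrow>
      real (r3 (Fp_power p n)) \<ge> (5001 / 10000 * real p) ^ n"
    using r3_eventually_ge[OF _ D F, of "5001 / 10000 * real p"] p by auto
qed simp

end
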